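(* Let $\mathcal{A}\subset\mathbb{N}$ be an infinite set. For any increasing sequence $\{N_t\}_{t\ge1}\subset\mathbb{N}$ such that $$\lim_{t\to\infty}N_t^{-3}E(A_{N_t})=0,$$ there exists a subsequence of $\{N_t\}$ along which $\mathcal{A}$ has doubly metric Poissonian pair correlations.
   Context: $\mathbb{N}=\{1,2,3,\dots\}$, $\mathbb{T}=\mathbb{R}/\mathbb{Z}$, $\|\cdot\|$ denotes distance to $0$ in $\mathbb{T}$, and $[N]=\{1,\dots,N\}$. For an infinite set $\mathcal{A}\subset\mathbb{N}$, enumerate its elements in increasing order as $a_1<a_2<\cdots$, and let $A_N=\{a_1,\dots,a_N\}$ be the set of its smallest $N$ elements. The additive energy of a finite set $A$ of integers is $$E(A)=\#\{(a,b,c,d)\in A^4 : a+b=c+d\}.$$ For $\alpha,\gamma\in\mathbb{T}$, $s>0$, $N\in\mathbb{N}$, define $$F(\alpha,\gamma,s,N,\mathcal{A})=\frac1N\#\Big\{(i,j)\in[N]\times[N] : i\neq j,\ \|a_i\alpha-a_j\alpha-\gamma\|\le \frac sN\Big\}.$$ For an increasing sequence $\{M_t\}\subset\mathbb{N}$, the set $\mathcal{A}$ has doubly metric Poissonian pair correlations along $\{M_t\}$ if for Lebesgue-almost every pair $(\alpha,\gamma)\in\mathbb{T}^2$ one has $\lim_{t\to\infty}F(\alpha,\gamma,s,M_t,\mathcal{A})=2s$ for every real $s>0$. *)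

theory Defs
  imports "HOL-Analysis.Analysis"
begin

text \<open>
  Points of the torus \<open>\<real>/\<int>\<close> are given by real representatives. For a real \<open>x\<close>,
  \<open>infdist x \<int>\<close> is the infimum of \<open>\<bar>x - n\<bar>\<close> over the integers \<open>n\<close>, which is the
  distance from the class of \<open>x\<close> to \<open>0\<close>.
\<close>

definition torus_norm :: "real \<Rightarrow> real" where
  "torus_norm x = infdist x \<int>"

text \<open>
  Lebesgue measure on the torus, carried by the fundamental domain \<open>[0,1)\<close>.
  Borel and completed Lebesgue measure give the same meaning to \<open>AE\<close>.
\<close>

definition torus_measure :: "real measure" where
  "torus_measure = restrict_space lborel {0..<1}"

text \<open>
  Elements are numbered from 1, as \<open>a\<^sub>1 < a\<^sub>2 < \<dots>\<close>, whereas \<^const>\<open>enumerate\<close> starts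
  at index 0. The value at index 0 is never used.
\<close>

definition elt :: "nat set \<Rightarrow> nat \<Rightarrow> nat" where
  "elt A i = enumerate A (i - 1)"

definition initial_part :: "nat set \<Rightarrow> nat \<Rightarrow> nat set" where
  "initial_part A N = elt A ` {1..N}"

definition additive_energy :: "'a::plus set \<Rightarrow> nat" where
  "additive_energy A =
     card {(a, b, c, d). a \<in> A \<and> b \<in> A \<and> c \<in> A \<and> d \<in> A \<and> a + b = c + d}"

definition pair_corr :: "real \<Rightarrow> real \<Rightarrow> real \<Rightarrow> nat \<Rightarrow> nat set \<Rightarrow> real" where
  "pair_corr \<alpha> \<gamma> s N A =
     1 / real N *
     real (card {(i, j). i \<in> {1..N} \<and> j \<in> {1..N} \<and> i \<noteq> j \<and>
       torus_norm (real (elt A i) * \<alpha> - real (elt A j) * \<alpha> - \<gamma>) \<le> s / real N})"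

definition doubly_metric_poissonian_along :: "nat set \<Rightarrow> (nat \<Rightarrow> nat) \<Rightarrow> bool" where
  "doubly_metric_poissonian_along A M \<longleftrightarrow>
     (AE (\<alpha>, \<gamma>) in torus_measure \<Otimes>\<^sub>M torus_measure.
        \<forall>s>0. (\<lambda>t. pair_corr \<alpha> \<gamma> s (M t) A) \<longlonglongrightarrow> 2 * s)"

lemma torus_norm_add_int: "torus_norm (x + of_int k) = torus_norm x"
proof -
  have le: "infdist (y + of_int m) \<int> \<le> infdist y \<int>" for y :: real and m :: int
  proof -
    have ne: "(\<int> :: real set) \<noteq> {}" by auto
    have "infdist (y + of_int m) \<int> \<le> dist y n" if "n \<in> \<int>" for n
      using infdist_le[of "n + of_int m" "\<int>" "y + of_int m"] that
      by (simp add: dist_real_def)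
    then show ?thesis
      unfolding infdist_notempty[OF ne, of y] by (intro cINF_greatest ne) auto
  qed
  from le[of x k] le[of "x + of_int k" "- k"] show ?thesis
    unfolding torus_norm_def by simp
qed

text \<open>The counting function depends only on the classes of \<open>\<alpha>\<close> and \<open>\<gamma>\<close> in \<open>\<real>/\<int>\<close>.\<close>

lemma pair_corr_add_int:
  "pair_corr (\<alpha> + of_int k) (\<gamma> + of_int l) s N A = pair_corr \<alpha> \<gamma> s N A"
proof -
  have "torus_norm (real m * (\<alpha> + of_int k) - real n * (\<alpha> + of_int k) - (\<gamma> + of_int l)) =
        torus_norm (real m * \<alpha> - real n * \<alpha> - \<gamma>)" for m n
    using torus_norm_add_int[of "real m * \<alpha> - real n * \<alpha> - \<gamma>" "int m * k - int n * k - l"]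
    by (simp add: algebra_simps)
  then show ?thesis unfolding pair_corr_def by simp
qed

end

theory Submission
  imports Defs "HOL-Probability.Probability"
begin

text \<open>
  For an integer \<open>d\<close> let \<open>B\<^sub>d\<close> be the set of \<open>(\<alpha>, \<gamma>)\<close> with \<open>\<parallel>d \<alpha> - \<gamma>\<parallel> \<le> \<delta>\<close>, where \<open>\<delta> = s/N < 1/2\<close>.
  These events have probability \<open>2 \<delta>\<close> and are pairwise independent, so in the variance of the pair
  correlation function only pairs of pairs with equal differences survive, and the variance is at
  most \<open>2 s E(A\<^sub>N) / N\<^sup>3\<close>. Along a subsequence on which \<open>E(A\<^sub>N) / N\<^sup>3\<close> is summable the pair
  correlations converge almost surely for each fixed \<open>s\<close>, hence for all rational \<open>s > 0\<close> at once,
  and then for all real \<open>s > 0\<close> by monotonicity in \<open>s\<close>.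
\<close>

section \<open>Integrals of 1-periodic functions over the torus\<close>

lemma periodic_add_int:
  fixes h :: "real \<Rightarrow> 'a"
  assumes "\<And>x. h (x + 1) = h x"
  shows "h (x + of_int k) = h x"
proof (induction k rule: int_induct[where k = 0])
  case (step1 i)
  then show ?case using assms[of "x + of_int i"] by (simp add: add.assoc)
next
  case (step2 i)
  then show ?case using assms[of "x + of_int i - 1"] by (simp add: add_diff_eq)
qed simp

lemma nn_integral_torus_measure:
  "(\<integral>\<^sup>+x. h x \<partial>torus_measure) = (\<integral>\<^sup>+x. h x * indicator {0..<1} x \<partial>lborel)"
  unfolding torus_measure_def by (simp add: nn_integral_restrict_space)

lemma measurable_torus_measure1:
  "h \<in> borel \<rightarrow>\<^sub>M M \<Longrightarrow> h \<in> torus_measure \<rightarrow>\<^sub>M M"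
  unfolding torus_measure_def by (rule measurable_restrict_space1) simp

text \<open>By periodicity \<open>c\<close> may be replaced by its fractional part \<open>f\<close>.
  The substitution moves the window to [f, f+1); the part of it beyond 1 is carried back by one
  period to [0, f) and completes [f, 1) to the unit interval.\<close>

lemma nn_integral_torus_shift:
  fixes h :: "real \<Rightarrow> ennreal"
  assumes [measurable]: "h \<in> borel_measurable borel" and per: "\<And>x. h (x + 1) = h x"
  shows "(\<integral>\<^sup>+x. h (c + x) \<partial>torus_measure) = (\<integral>\<^sup>+x. h x \<partial>torus_measure)"
proof -
  define f where "f = frac c"
  have f: "0 \<le> f" "f < 1" by (auto simp: f_def frac_lt_1)
  have "h (c + x) = h (f + x)" for x
    using periodic_add_int[of h "f + x" "\<lfloor>c\<rfloor>"] per by (simp add: f_def frac_def algebra_simps)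
  then have "(\<integral>\<^sup>+x. h (c + x) \<partial>torus_measure) = (\<integral>\<^sup>+x. h (f + x) * indicator {0..<1} x \<partial>lborel)"
    by (simp add: nn_integral_torus_measure)
  also have "\<dots> = (\<integral>\<^sup>+x. h (f + x) * indicator {f..<f+1} (f + x) \<partial>lborel)"
    by (intro nn_integral_cong) (auto simp: indicator_def)
  also have "\<dots> = (\<integral>\<^sup>+y. h y * indicator {f..<f+1} y \<partial>lborel)"
    using nn_integral_real_affine[of "\<lambda>y. h y * indicator {f..<f+1} y" 1 f] by simp
  also have "\<dots> = (\<integral>\<^sup>+y. h y * indicator {f..<1} y + h y * indicator {1..<f+1} y \<partial>lborel)"
    using f by (intro nn_integral_cong) (auto simp: indicator_def)
  also have "\<dots> = (\<integral>\<^sup>+y. h y * indicator {f..<1} y \<partial>lborel) + (\<integral>\<^sup>+y. h y * indicator {1..<f+1} y \<partial>lborel)"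
    by (rule nn_integral_add) auto
  also have "(\<integral>\<^sup>+y. h y * indicator {1..<f+1} y \<partial>lborel)
      = (\<integral>\<^sup>+y. h (1 + y) * indicator {1..<f+1} (1 + y) \<partial>lborel)"
    using nn_integral_real_affine[of "\<lambda>y. h y * indicator {1..<f+1} y" 1 1] by simp
  also have "\<dots> = (\<integral>\<^sup>+y. h y * indicator {0..<f} y \<partial>lborel)"
    using per by (intro nn_integral_cong) (auto simp: indicator_def add.commute)
  also have "(\<integral>\<^sup>+y. h y * indicator {f..<1} y \<partial>lborel) + (\<integral>\<^sup>+y. h y * indicator {0..<f} y \<partial>lborel)
      = (\<integral>\<^sup>+y. h y * indicator {f..<1} y + h y * indicator {0..<f} y \<partial>lborel)"
    by (rule nn_integral_add[symmetric]) auto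
  also have "\<dots> = (\<integral>\<^sup>+y. h y * indicator {0..<1} y \<partial>lborel)"
    using f by (intro nn_integral_cong) (auto simp: indicator_def)
  finally show ?thesis by (simp add: nn_integral_torus_measure)
qed

text \<open>The integral of \<open>h\<close> over [0, n) is evaluated twice: as n full periods, and
  by substituting y = n x, whose Jacobian contributes the same factor n.\<close>

lemma nn_integral_torus_dilate:
  fixes h :: "real \<Rightarrow> ennreal"
  assumes [measurable]: "h \<in> borel_measurable borel" and per: "\<And>x. h (x + 1) = h x"
    and "n > 0"
  shows "(\<integral>\<^sup>+x. h (real n * x) \<partial>torus_measure) = (\<integral>\<^sup>+x. h x \<partial>torus_measure)"
proof -
  let ?I = "\<integral>\<^sup>+x. h x \<partial>torus_measure"
  let ?J = "\<lambda>m. \<integral>\<^sup>+y. h y * indicator {0..<real m} y \<partial>lborel"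
  have J: "?J m = of_nat m * ?I" for m
  proof (induction m)
    case (Suc m)
    have "?J (Suc m) = (\<integral>\<^sup>+y. h y * indicator {0..<real m} y + h y * indicator {real m..<real m + 1} y \<partial>lborel)"
      by (intro nn_integral_cong) (auto simp: indicator_def)
    also have "\<dots> = ?J m + (\<integral>\<^sup>+y. h y * indicator {real m..<real m + 1} y \<partial>lborel)"
      by (rule nn_integral_add) auto
    also have "(\<integral>\<^sup>+y. h y * indicator {real m..<real m + 1} y \<partial>lborel)
        = (\<integral>\<^sup>+y. h (real m + y) * indicator {real m..<real m + 1} (real m + y) \<partial>lborel)"
      using nn_integral_real_affine[of "\<lambda>y. h y * indicator {real m..<real m + 1} y" 1 "real m"] by simp
    also have "\<dots> = (\<integral>\<^sup>+y. h y * indicator {0..<1} y \<partial>lborel)"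
      using periodic_add_int[of h _ "int m"] per
      by (intro nn_integral_cong) (auto simp: indicator_def add.commute)
    finally show ?case by (simp add: Suc nn_integral_torus_measure distrib_right add.commute)
  qed simp
  have "of_nat n * ?I = ?J n" by (simp add: J)
  also have "\<dots> = ennreal (real n) * (\<integral>\<^sup>+y. h (real n * y) * indicator {0..<real n} (real n * y) \<partial>lborel)"
    using nn_integral_real_affine[of "\<lambda>y. h y * indicator {0..<real n} y" "real n" 0] \<open>n > 0\<close> by simp
  also have "(\<integral>\<^sup>+y. h (real n * y) * indicator {0..<real n} (real n * y) \<partial>lborel)
     = (\<integral>\<^sup>+y. h (real n * y) * indicator {0..<1} y \<partial>lborel)"
    using \<open>n > 0\<close> by (intro nn_integral_cong) (auto simp: indicator_def zero_le_mult_iff)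
  also have "\<dots> = (\<integral>\<^sup>+x. h (real n * x) \<partial>torus_measure)"
    by (simp add: nn_integral_torus_measure)
  \<comment> \<open>The factor n is positive and finite, so it cancels in \<open>ennreal\<close>
    even if the integrals are infinite.\<close>
  finally show ?thesis
    using \<open>n > 0\<close> by (simp add: ennreal_of_nat_eq_real_of_nat ennreal_mult_cancel_left)
qed

text \<open>Dilation followed by translation settles positive \<open>k\<close>. For negative
  \<open>k\<close>, evenness replaces the argument by its negative, whose leading coefficient is
  positive.\<close>

lemma nn_integral_torus_affine:
  fixes h :: "real \<Rightarrow> ennreal"
  assumes [measurable]: "h \<in> borel_measurable borel" and per: "\<And>x. h (x + 1) = h x"
    and even: "\<And>x. h (- x) = h x" and "k \<noteq> 0"
  shows "(\<integral>\<^sup>+x. h (c + of_int k * x) \<partial>torus_measure) = (\<integral>\<^sup>+x. h x \<partial>torus_measure)"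
proof -
  have pos: "(\<integral>\<^sup>+x. h (b + real n * x) \<partial>torus_measure) = (\<integral>\<^sup>+x. h x \<partial>torus_measure)"
    if "n > 0" for b n
    using nn_integral_torus_dilate[of "\<lambda>x. h (b + x)" n] nn_integral_torus_shift[of h b] per that
    by (simp add: add.assoc[symmetric])
  show ?thesis
  proof (cases "k > 0")
    case True
    then show ?thesis using pos[of "nat k" c] by simp
  next
    case False
    then have "h (c + of_int k * x) = h (- c + real (nat (- k)) * x)" for x
      using even[of "c + of_int k * x"] by simp
    then show ?thesis using pos[of "nat (- k)" "- c"] False \<open>k \<noteq> 0\<close> by simp
  qed
qed

section \<open>The torus norm and the measure of its balls\<close>

text \<open>The integers form a closed set, so the infimum defining the distance is attained and the
  non-strict inequality passes to an actual integer.\<close>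

lemma torus_norm_le_iff: "torus_norm x \<le> \<delta> \<longleftrightarrow> (\<exists>n::int. \<bar>x - of_int n\<bar> \<le> \<delta>)"
proof
  assume "torus_norm x \<le> \<delta>"
  moreover obtain y where "y \<in> \<int>" "infdist x \<int> = dist x y"
    using infdist_attains_inf[of "\<int>::real set" x] closed_Ints by blast
  ultimately show "\<exists>n::int. \<bar>x - of_int n\<bar> \<le> \<delta>"
    by (auto simp: torus_norm_def dist_real_def Ints_def)
next
  assume "\<exists>n::int. \<bar>x - of_int n\<bar> \<le> \<delta>"
  then obtain n :: int where "dist x (of_int n) \<le> \<delta>" by (auto simp: dist_real_def)
  moreover have "infdist x \<int> \<le> dist x (of_int n)" by (rule infdist_le) simp
  ultimately show "torus_norm x \<le> \<delta>" unfolding torus_norm_def by simp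
qed

lemma torus_norm_minus: "torus_norm (- x) = torus_norm x"
proof -
  have "torus_norm (- y) \<le> torus_norm y" for y
  proof -
    obtain n :: int where "\<bar>y - of_int n\<bar> \<le> torus_norm y"
      using torus_norm_le_iff[of y "torus_norm y"] by auto
    then have "\<bar>- y - of_int (- n)\<bar> \<le> torus_norm y" by simp
    then show ?thesis using torus_norm_le_iff by blast
  qed
  from this[of x] this[of "- x"] show ?thesis by simp
qed

lemma borel_measurable_torus_norm [measurable]: "torus_norm \<in> borel_measurable borel"
  unfolding torus_norm_def by (intro borel_measurable_continuous_onI continuous_intros)

definition torus_ball :: "real \<Rightarrow> real set" where
  "torus_ball \<delta> = {x. torus_norm x \<le> \<delta>}"

lemma torus_ball_measurable [measurable]: "torus_ball \<delta> \<in> sets borel"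
  unfolding torus_ball_def by measurable

lemma torus_ball_add_1: "x + 1 \<in> torus_ball \<delta> \<longleftrightarrow> x \<in> torus_ball \<delta>"
  using torus_norm_add_int[of x 1] by (simp add: torus_ball_def)

lemma torus_ball_minus: "- x \<in> torus_ball \<delta> \<longleftrightarrow> x \<in> torus_ball \<delta>"
  by (simp add: torus_ball_def torus_norm_minus)

text \<open>Inside [0, 1) the ball consists of one interval of length \<open>\<delta>\<close> at
  each end.\<close>

lemma nn_integral_torus_ball:
  assumes "0 \<le> \<delta>" "\<delta> < 1/2"
  shows "(\<integral>\<^sup>+x. indicator (torus_ball \<delta>) x \<partial>torus_measure) = ennreal (2 * \<delta>)"
proof -
  have "x \<in> torus_ball \<delta> \<and> 0 \<le> x \<and> x < 1 \<longleftrightarrow> x \<in> {0..\<delta>} \<or> x \<in> {1-\<delta>..<1}" for x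
  proof
    assume x: "x \<in> torus_ball \<delta> \<and> 0 \<le> x \<and> x < 1"
    then obtain n :: int where n: "\<bar>x - of_int n\<bar> \<le> \<delta>" by (auto simp: torus_ball_def torus_norm_le_iff)
    \<comment> \<open>Since \<open>\<delta>\<close> is below 1/2, the integer n lies strictly
      between -1/2 and 3/2.\<close>
    then have "n = 0 \<or> n = 1" using x assms by linarith
    then show "x \<in> {0..\<delta>} \<or> x \<in> {1-\<delta>..<1}" using n x by auto
  next
    assume "x \<in> {0..\<delta>} \<or> x \<in> {1-\<delta>..<1}"
    then have "\<bar>x - of_int 0\<bar> \<le> \<delta> \<or> \<bar>x - of_int 1\<bar> \<le> \<delta>" "0 \<le> x" "x < 1" using assms by auto
    then show "x \<in> torus_ball \<delta> \<and> 0 \<le> x \<and> x < 1"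
      unfolding torus_ball_def torus_norm_le_iff by blast
  qed
  \<comment> \<open>The indicators may be added because the two intervals are disjoint:
    \<open>\<delta>\<close> < 1 - \<open>\<delta>\<close>.\<close>
  then have "indicator (torus_ball \<delta>) x * indicator {0..<1} x
      = (indicator {0..\<delta>} x + indicator {1-\<delta>..<1} x :: ennreal)" for x
    using assms by (auto simp: indicator_def)
  then have "(\<integral>\<^sup>+x. indicator (torus_ball \<delta>) x \<partial>torus_measure)
      = (\<integral>\<^sup>+x. indicator {0..\<delta>} x + indicator {1-\<delta>..<1} x \<partial>lborel)"
    by (simp add: nn_integral_torus_measure)
  also have "\<dots> = (\<integral>\<^sup>+x. indicator {0..\<delta>} x \<partial>lborel) + (\<integral>\<^sup>+x. indicator {1-\<delta>..<1} x \<partial>lborel)"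
    by (rule nn_integral_add) auto
  also have "\<dots> = ennreal (2 * \<delta>)"
    using assms by (simp add: ennreal_plus[symmetric] del: ennreal_plus)
  finally show ?thesis .
qed

section \<open>Strips in the product torus and their pairwise independence\<close>

interpretation torus: prob_space torus_measure
proof
  show "emeasure torus_measure (space torus_measure) = 1"
    unfolding torus_measure_def by (simp add: space_restrict_space emeasure_restrict_space)
qed

interpretation torus2: pair_prob_space torus_measure torus_measure ..

abbreviation torus2_measure :: "(real \<times> real) measure" where
  "torus2_measure \<equiv> torus_measure \<Otimes>\<^sub>M torus_measure"

lemma measurable_fst_torus2 [measurable]: "fst \<in> borel_measurable torus2_measure"
  by (rule measurable_compose[OF measurable_fst measurable_torus_measure1]) simp

lemma measurable_snd_torus2 [measurable]: "snd \<in> borel_measurable torus2_measure"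
  by (rule measurable_compose[OF measurable_snd measurable_torus_measure1]) simp

text \<open>These are the events written \<open>B\<^sub>d\<close> in the overview. Indexing them by
  the difference d, not by the index pair (i, j), makes it visible when two pairs give the same
  event.\<close>

definition strip :: "real \<Rightarrow> int \<Rightarrow> (real \<times> real) set" where
  "strip \<delta> d = {\<omega> \<in> space torus2_measure. of_int d * fst \<omega> - snd \<omega> \<in> torus_ball \<delta>}"

lemma strip_sets [measurable]: "strip \<delta> d \<in> sets torus2_measure"
  unfolding strip_def by measurable

text \<open>For fixed \<alpha> the variable \<gamma> is uniform, and reflecting and translating it
  does not change the measure of the ball. The inner integral is therefore the same for every
  \<alpha> and every d, including d = 0.\<close>

lemma prob_strip:
  assumes "0 \<le> \<delta>" "\<delta> < 1/2"
  shows "torus2.prob (strip \<delta> d) = 2 * \<delta>"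
proof -
  let ?h = "\<lambda>x. indicator (torus_ball \<delta>) x :: ennreal"
  have "emeasure torus2_measure (strip \<delta> d) = (\<integral>\<^sup>+\<omega>. ?h (of_int d * fst \<omega> - snd \<omega>) \<partial>torus2_measure)"
    unfolding nn_integral_indicator[OF strip_sets, symmetric]
    by (intro nn_integral_cong) (auto simp: strip_def indicator_def)
  also have "\<dots> = (\<integral>\<^sup>+\<alpha>. \<integral>\<^sup>+\<gamma>. ?h (of_int d * \<alpha> + of_int (-1) * \<gamma>) \<partial>torus_measure \<partial>torus_measure)"
    by (subst torus.nn_integral_fst[symmetric]) simp_all
  also have "\<dots> = ennreal (2 * \<delta>)"
    using assms
    by (subst nn_integral_torus_affine)
       (auto simp: nn_integral_torus_ball torus.emeasure_space_1 indicator_def torus_ball_add_1 torus_ball_minus)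
  finally show ?thesis using assms by (simp add: measure_def)
qed

text \<open>
  After translating \<open>\<gamma>\<close> by \<open>d\<^sub>1 \<alpha>\<close> the variable \<open>\<alpha>\<close> occurs only through
  \<open>(d\<^sub>2 - d\<^sub>1) \<alpha>\<close>, which is equidistributed.
\<close>

lemma prob_strip_Int:
  assumes \<delta>: "0 \<le> \<delta>" "\<delta> < 1/2" and "d1 \<noteq> d2"
  shows "torus2.prob (strip \<delta> d1 \<inter> strip \<delta> d2) = (2 * \<delta>)\<^sup>2"
proof -
  let ?h = "\<lambda>x. indicator (torus_ball \<delta>) x :: ennreal"
  let ?T = torus_measure
  have per: "?h (x + 1) = ?h x" and ev: "?h (- x) = ?h x" for x
    by (auto simp: indicator_def torus_ball_add_1 torus_ball_minus)
  have shift: "(\<integral>\<^sup>+\<gamma>. ?h (of_int d1 * \<alpha> - \<gamma>) * ?h (of_int d2 * \<alpha> - \<gamma>) \<partial>?T)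
      = (\<integral>\<^sup>+\<gamma>. ?h \<gamma> * ?h (of_int (d2 - d1) * \<alpha> - \<gamma>) \<partial>?T)" for \<alpha> :: real
  proof -
    let ?g = "\<lambda>\<gamma>. ?h (of_int d1 * \<alpha> - \<gamma>) * ?h (of_int d2 * \<alpha> - \<gamma>)"
    have "?h (y - (x + 1)) = ?h (y - x)" for x y
      using per[of "y - x - 1"] by (simp add: algebra_simps)
    then have "(\<integral>\<^sup>+\<gamma>. ?g \<gamma> \<partial>?T) = (\<integral>\<^sup>+\<gamma>. ?g (of_int d1 * \<alpha> + \<gamma>) \<partial>?T)"
      by (intro nn_integral_torus_shift[symmetric]) auto
    also have "\<dots> = (\<integral>\<^sup>+\<gamma>. ?h \<gamma> * ?h (of_int (d2 - d1) * \<alpha> - \<gamma>) \<partial>?T)"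
      by (intro nn_integral_cong) (simp add: ev algebra_simps)
    finally show ?thesis .
  qed
  have "emeasure torus2_measure (strip \<delta> d1 \<inter> strip \<delta> d2)
      = (\<integral>\<^sup>+\<omega>. ?h (of_int d1 * fst \<omega> - snd \<omega>) * ?h (of_int d2 * fst \<omega> - snd \<omega>) \<partial>torus2_measure)"
    unfolding nn_integral_indicator[OF sets.Int[OF strip_sets strip_sets], symmetric]
    by (intro nn_integral_cong) (auto simp: strip_def indicator_def)
  also have "\<dots> = (\<integral>\<^sup>+\<alpha>. \<integral>\<^sup>+\<gamma>. ?h (of_int d1 * \<alpha> - \<gamma>) * ?h (of_int d2 * \<alpha> - \<gamma>) \<partial>?T \<partial>?T)"
    by (subst torus.nn_integral_fst[symmetric]) simp_all
  also have "\<dots> = (\<integral>\<^sup>+\<alpha>. \<integral>\<^sup>+\<gamma>. ?h \<gamma> * ?h (of_int (d2 - d1) * \<alpha> - \<gamma>) \<partial>?T \<partial>?T)"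
    by (simp only: shift)
  \<comment> \<open>The order of integration is exchanged because the coefficient
    \<open>d2 - d1\<close> of \<alpha> is nonzero: the integral over \<alpha> then no longer depends
    on \<gamma>, and the double integral factors.\<close>
  also have "\<dots> = (\<integral>\<^sup>+\<gamma>. \<integral>\<^sup>+\<alpha>. ?h \<gamma> * ?h (of_int (d2 - d1) * \<alpha> - \<gamma>) \<partial>?T \<partial>?T)"
  proof -
    have "(\<lambda>\<omega>. ?h (snd \<omega>) * ?h (of_int (d2 - d1) * fst \<omega> - snd \<omega>)) \<in> borel_measurable torus2_measure"
      by measurable
    then show ?thesis by (intro torus2.Fubini'[symmetric]) (simp add: split_def)
  qed
  also have "\<dots> = (\<integral>\<^sup>+\<gamma>. ?h \<gamma> * (\<integral>\<^sup>+\<alpha>. ?h (- \<gamma> + of_int (d2 - d1) * \<alpha>) \<partial>?T) \<partial>?T)"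
    by (intro nn_integral_cong)
       (subst nn_integral_cmult[symmetric], auto intro!: measurable_torus_measure1 simp: algebra_simps)
  also have "\<dots> = (\<integral>\<^sup>+\<gamma>. ?h \<gamma> * ennreal (2 * \<delta>) \<partial>?T)"
    using \<open>d1 \<noteq> d2\<close> by (subst nn_integral_torus_affine) (auto simp: per ev nn_integral_torus_ball[OF \<delta>])
  also have "\<dots> = ennreal (2 * \<delta>) * ennreal (2 * \<delta>)"
    by (subst nn_integral_multc)
       (auto intro!: measurable_torus_measure1 simp: nn_integral_torus_ball[OF \<delta>])
  finally show ?thesis
    using \<delta> by (simp add: measure_def ennreal_mult[symmetric] power2_eq_square)
qed

text \<open>Pairwise independence off the diagonal leaves only the index pairs with \<open>d p = d q\<close>.\<close>

lemma strip_count_variance: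
  assumes \<delta>: "0 \<le> \<delta>" "\<delta> < 1/2" and "finite P"
  shows "torus2.expectation (\<lambda>\<omega>. ((\<Sum>p\<in>P. indicator (strip \<delta> (d p)) \<omega>) - 2 * \<delta> * real (card P))\<^sup>2)
    \<le> 2 * \<delta> * real (card {(p, q). p \<in> P \<and> q \<in> P \<and> d p = d q})"
proof -
  let ?B = "\<lambda>p. strip \<delta> (d p)"
  let ?i = "\<lambda>p \<omega>. indicator (?B p) \<omega> :: real"
  have int: "integrable torus2_measure (\<lambda>\<omega>. ?i p \<omega> * ?i q \<omega>)"
       "integrable torus2_measure (?i p)" for p q
    by (auto simp: indicator_inter_arith[symmetric] torus2.emeasure_eq_measure)
  have "((\<Sum>p\<in>P. ?i p \<omega>) - 2 * \<delta> * real (card P))\<^sup>2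
      = (\<Sum>p\<in>P. \<Sum>q\<in>P. (?i p \<omega> - 2 * \<delta>) * (?i q \<omega> - 2 * \<delta>))" for \<omega>
    unfolding sum_product[symmetric] by (simp add: power2_eq_square sum_subtractf mult.commute)
  then have eq: "((\<Sum>p\<in>P. ?i p \<omega>) - 2 * \<delta> * real (card P))\<^sup>2
      = (\<Sum>p\<in>P. \<Sum>q\<in>P. ?i p \<omega> * ?i q \<omega> - 2 * \<delta> * ?i p \<omega> - 2 * \<delta> * ?i q \<omega> + (2 * \<delta>)\<^sup>2)" for \<omega>
    by (simp add: algebra_simps power2_eq_square)
  \<comment> \<open>For equal differences the covariance is 2\<open>\<delta>\<close> -
    (2\<open>\<delta>\<close>)^2, and the negative term is discarded; for distinct differences it
    vanishes by independence.\<close>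
  have cov: "torus2.expectation (\<lambda>\<omega>. ?i p \<omega> * ?i q \<omega> - 2 * \<delta> * ?i p \<omega> - 2 * \<delta> * ?i q \<omega> + (2 * \<delta>)\<^sup>2)
      \<le> (if d p = d q then 2 * \<delta> else 0)" for p q
  proof -
    have "torus2.expectation (\<lambda>\<omega>. ?i p \<omega> * ?i q \<omega> - 2 * \<delta> * ?i p \<omega> - 2 * \<delta> * ?i q \<omega> + (2 * \<delta>)\<^sup>2)
      = torus2.prob (?B p \<inter> ?B q) - (2 * \<delta>)\<^sup>2"
      using int \<delta>
      by (simp add: indicator_inter_arith[symmetric] prob_strip torus2.prob_space power2_eq_square)
    then show ?thesis
      using prob_strip_Int[OF \<delta>, of "d p" "d q"] prob_strip[OF \<delta>, of "d q"] by auto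
  qed
  have "torus2.expectation (\<lambda>\<omega>. ((\<Sum>p\<in>P. ?i p \<omega>) - 2 * \<delta> * real (card P))\<^sup>2)
      = (\<Sum>p\<in>P. \<Sum>q\<in>P. torus2.expectation
          (\<lambda>\<omega>. ?i p \<omega> * ?i q \<omega> - 2 * \<delta> * ?i p \<omega> - 2 * \<delta> * ?i q \<omega> + (2 * \<delta>)\<^sup>2))"
    unfolding eq using int
    by (subst Bochner_Integration.integral_sum, force, intro sum.cong refl Bochner_Integration.integral_sum) auto
  also have "\<dots> \<le> (\<Sum>p\<in>P. \<Sum>q\<in>P. (if d p = d q then 2 * \<delta> else 0))"
    by (intro sum_mono cov)
  also have "\<dots> = (\<Sum>z\<in>P\<times>P. (if d (fst z) = d (snd z) then 2 * \<delta> else 0))"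
    by (simp add: sum.cartesian_product split_def)
  also have "\<dots> = (\<Sum>z\<in>{z\<in>P\<times>P. d (fst z) = d (snd z)}. 2 * \<delta>)"
    using \<open>finite P\<close> by (intro sum.inter_filter[symmetric]) auto
  also have "{z\<in>P\<times>P. d (fst z) = d (snd z)} = {(p, q). p \<in> P \<and> q \<in> P \<and> d p = d q}" by auto
  finally show ?thesis by (simp add: mult.commute)
qed

section \<open>Additive energy as a bound for the variance of the pair correlation function\<close>

lemma elt_inj_on:
  assumes "infinite A"
  shows "inj_on (elt A) {1..n}"
proof (rule inj_onI)
  fix i j assume ij: "i \<in> {1..n}" "j \<in> {1..n}" "elt A i = elt A j"
  then have "i - 1 = j - 1"
    using strict_mono_enumerate[OF assms] unfolding elt_def by (simp add: strict_mono_eq)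
  \<comment> \<open>Truncated subtraction sends the indices 0 and 1 to the same value; this is
    harmless as the range starts at 1.\<close>
  with ij show "i = j" by auto
qed

text \<open>The equation \<open>a\<^sub>i\<close> - \<open>a\<^sub>j\<close> =
  \<open>a\<^sub>k\<close> - \<open>a\<^sub>l\<close> rearranges to \<open>a\<^sub>i\<close> +
  \<open>a\<^sub>l\<close> = \<open>a\<^sub>k\<close> + \<open>a\<^sub>j\<close>, which maps the
  pairs of index pairs injectively into the quadruples counted by the energy.\<close>

lemma card_equal_differences_le:
  fixes A :: "nat set" and n :: nat
  assumes "infinite A"
  defines "P \<equiv> {(i, j). i \<in> {1..n} \<and> j \<in> {1..n} \<and> i \<noteq> j}"
    and "d \<equiv> \<lambda>(i, j). int (elt A i) - int (elt A j)"
  shows "card {(p, q). p \<in> P \<and> q \<in> P \<and> d p = d q} \<le> additive_energy (initial_part A n)"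
proof -
  let ?I = "initial_part A n"
  let ?f = "\<lambda>((i, j), (k, l)). (elt A i, elt A l, elt A k, elt A j)"
  let ?Q = "{(a, b, c, d). a \<in> ?I \<and> b \<in> ?I \<and> c \<in> ?I \<and> d \<in> ?I \<and> a + b = c + d}"
  have "finite ?I" by (simp add: initial_part_def)
  then have "finite (?I \<times> ?I \<times> ?I \<times> ?I)" by simp
  then have "finite ?Q" by (rule rev_finite_subset) auto
  moreover have "inj_on ?f {(p, q). p \<in> P \<and> q \<in> P \<and> d p = d q}"
    by (rule inj_onI) (auto simp: P_def inj_on_eq_iff[OF elt_inj_on[OF assms(1), of n]])
  moreover have "?f ` {(p, q). p \<in> P \<and> q \<in> P \<and> d p = d q} \<subseteq> ?Q"
    by (auto simp: P_def d_def initial_part_def)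
  ultimately show ?thesis unfolding additive_energy_def by (intro card_inj_on_le[of ?f])
qed

text \<open>The centre 2s(1 - 1/n) is the exact mean, slightly below 2s because the diagonal i = j
  is excluded. The hypothesis on \<open>n\<close> makes s/n < 1/2, as the strip estimates
  require.\<close>

lemma pair_corr_variance:
  assumes "infinite A" and "s > 0" and n: "real n > 2 * s"
  shows "torus2.expectation (\<lambda>\<omega>. (pair_corr (fst \<omega>) (snd \<omega>) s n A - 2 * s * (1 - 1 / real n))\<^sup>2)
    \<le> 2 * s * (real (additive_energy (initial_part A n)) / real n ^ 3)"
    and "(\<lambda>\<omega>. pair_corr (fst \<omega>) (snd \<omega>) s n A) \<in> borel_measurable torus2_measure"
proof -
  define P where "P = {(i, j). i \<in> {1..n} \<and> j \<in> {1..n} \<and> i \<noteq> j}"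
  define d where "d = (\<lambda>(i, j). int (elt A i) - int (elt A j))"
  define \<delta> where "\<delta> = s / real n"
  have n0: "real n > 0" using assms by linarith
  have \<delta>: "0 \<le> \<delta>" "\<delta> < 1/2" using assms n0 by (auto simp: \<delta>_def field_simps)
  have "finite P" by (rule finite_subset[of _ "{1..n} \<times> {1..n}"]) (auto simp: P_def)
  have cardP: "real (card P) = real n * (real n - 1)"
  proof -
    have "P = {1..n} \<times> {1..n} - (\<lambda>i. (i, i)) ` {1..n}" by (auto simp: P_def)
    then have "card P = card ({1..n} \<times> {1..n}) - card ((\<lambda>i. (i, i)) ` {1..n})"
      by (simp add: card_Diff_subset image_subset_iff)
    also have "card ((\<lambda>i. (i, i)) ` {1..n}) = n" by (subst card_image) (auto simp: inj_on_def)
    finally have "card P = n * n - n" by simp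
    then show ?thesis using n0 by (simp add: algebra_simps)
  qed
  \<comment> \<open>The identity is restricted to the space because \<open>strip\<close> contains no
    other points.\<close>
  have F: "pair_corr (fst \<omega>) (snd \<omega>) s n A = 1 / real n * (\<Sum>p\<in>P. indicator (strip \<delta> (d p)) \<omega>)"
    if "\<omega> \<in> space torus2_measure" for \<omega>
  proof -
    have "{(i, j). i \<in> {1..n} \<and> j \<in> {1..n} \<and> i \<noteq> j \<and>
       torus_norm (real (elt A i) * fst \<omega> - real (elt A j) * fst \<omega> - snd \<omega>) \<le> s / real n}
       = {p\<in>P. \<omega> \<in> strip \<delta> (d p)}"
      using that by (auto simp: P_def d_def strip_def torus_ball_def \<delta>_def left_diff_distrib)
    moreover have "(\<Sum>p\<in>P. indicator (strip \<delta> (d p)) \<omega>) = real (card {p\<in>P. \<omega> \<in> strip \<delta> (d p)})"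
      using \<open>finite P\<close> by (simp add: indicator_def sum.If_cases Int_def)
    ultimately show ?thesis unfolding pair_corr_def by simp
  qed
  have "(\<lambda>\<omega>. 1 / real n * (\<Sum>p\<in>P. indicator (strip \<delta> (d p)) \<omega>)) \<in> borel_measurable torus2_measure"
    by measurable
  then show "(\<lambda>\<omega>. pair_corr (fst \<omega>) (snd \<omega>) s n A) \<in> borel_measurable torus2_measure"
    using F by (subst measurable_cong) auto
  let ?S = "\<lambda>\<omega>. ((\<Sum>p\<in>P. indicator (strip \<delta> (d p)) \<omega>) - 2 * \<delta> * real (card P))\<^sup>2"
  have "(pair_corr (fst \<omega>) (snd \<omega>) s n A - 2 * s * (1 - 1 / real n))\<^sup>2 = (1 / real n)\<^sup>2 * ?S \<omega>"
    if "\<omega> \<in> space torus2_measure" for \<omega>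
  proof -
    \<comment> \<open>There are n(n-1) ordered pairs, each contributing probability 2s/n, and the
      count is divided by n.\<close>
    have "2 * s * (1 - 1 / real n) = 1 / real n * (2 * \<delta> * real (card P))"
      unfolding cardP using n0 by (simp add: \<delta>_def field_simps)
    then show ?thesis
      unfolding F[OF that] power_mult_distrib[symmetric] by (simp only: right_diff_distrib)
  qed
  then have "torus2.expectation (\<lambda>\<omega>. (pair_corr (fst \<omega>) (snd \<omega>) s n A - 2 * s * (1 - 1 / real n))\<^sup>2)
      = torus2.expectation (\<lambda>\<omega>. (1 / real n)\<^sup>2 * ?S \<omega>)"
    by (intro Bochner_Integration.integral_cong) auto
  also have "\<dots> = (1 / real n)\<^sup>2 * torus2.expectation ?S" by simp
  also have "\<dots> \<le> (1 / real n)\<^sup>2 * (2 * \<delta> * real (card {(p, q). p \<in> P \<and> q \<in> P \<and> d p = d q}))"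
    by (intro mult_left_mono strip_count_variance \<delta> \<open>finite P\<close>) simp
  also have "\<dots> \<le> (1 / real n)\<^sup>2 * (2 * \<delta> * real (additive_energy (initial_part A n)))"
    using card_equal_differences_le[OF assms(1), of n] \<delta>
    by (intro mult_left_mono) (auto simp: P_def d_def)
  also have "\<dots> = 2 * s * (real (additive_energy (initial_part A n)) / real n ^ 3)"
    by (simp add: \<delta>_def power2_eq_square power3_eq_cube)
  finally show "torus2.expectation (\<lambda>\<omega>. (pair_corr (fst \<omega>) (snd \<omega>) s n A - 2 * s * (1 - 1 / real n))\<^sup>2)
    \<le> 2 * s * (real (additive_energy (initial_part A n)) / real n ^ 3)" .
qed

lemma pair_corr_mono:
  assumes "s \<le> s'"
  shows "pair_corr \<alpha> \<gamma> s n A \<le> pair_corr \<alpha> \<gamma> s' n A"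
proof -
  have "finite {(i, j). i \<in> {1..n} \<and> j \<in> {1..n} \<and> i \<noteq> j \<and> Q i j}" for Q
    by (rule finite_subset[of _ "{1..n} \<times> {1..n}"]) auto
  moreover have "s / real n \<le> s' / real n" using assms by (simp add: divide_right_mono)
  ultimately show ?thesis
    unfolding pair_corr_def by (intro mult_left_mono of_nat_mono card_mono) auto
qed

text \<open>A crude bound, which serves to make the squared deviations integrable.\<close>

lemma pair_corr_bounded: "pair_corr \<alpha> \<gamma> s n A \<in> {0..real n}"
proof -
  have "card {(i, j). i \<in> {1..n} \<and> j \<in> {1..n} \<and> i \<noteq> j \<and>
       torus_norm (real (elt A i) * \<alpha> - real (elt A j) * \<alpha> - \<gamma>) \<le> s / real n} \<le> card ({1..n} \<times> {1..n})"
    by (intro card_mono) auto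
  then have "real (card {(i, j). i \<in> {1..n} \<and> j \<in> {1..n} \<and> i \<noteq> j \<and>
       torus_norm (real (elt A i) * \<alpha> - real (elt A j) * \<alpha> - \<gamma>) \<le> s / real n}) \<le> real n * real n"
    by (simp flip: of_nat_mult)
  then show ?thesis unfolding pair_corr_def by (cases "n = 0") (auto simp: field_simps)
qed

section \<open>Almost sure convergence from summable variances\<close>

text \<open>Sum and integral of nonnegative functions may be exchanged, so the sum of the squares
  has finite integral. It is then finite almost everywhere, and its terms tend to 0.\<close>

lemma (in prob_space) AE_LIMSEQ_of_summable_second_moment:
  fixes X :: "nat \<Rightarrow> 'a \<Rightarrow> real"
  assumes int: "\<And>t. integrable M (\<lambda>\<omega>. (X t \<omega>)\<^sup>2)"
    and le: "\<And>t. expectation (\<lambda>\<omega>. (X t \<omega>)\<^sup>2) \<le> c t" and "summable c"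
  shows "AE \<omega> in M. (\<lambda>t. X t \<omega>) \<longlonglongrightarrow> 0"
proof -
  have [measurable]: "(\<lambda>\<omega>. (X t \<omega>)\<^sup>2) \<in> borel_measurable M" for t using int by auto
  have "0 \<le> c t" for t using le[of t] by (rule order_trans[rotated]) simp
  have "(\<integral>\<^sup>+\<omega>. (\<Sum>t. ennreal ((X t \<omega>)\<^sup>2)) \<partial>M) = (\<Sum>t. \<integral>\<^sup>+\<omega>. ennreal ((X t \<omega>)\<^sup>2) \<partial>M)"
    by (rule nn_integral_suminf) measurable
  also have "\<dots> \<le> (\<Sum>t. ennreal (c t))"
    using int le by (intro suminf_le) (auto simp: nn_integral_eq_integral ennreal_leI)
  also have "\<dots> < \<infinity>"
    using \<open>summable c\<close> \<open>\<And>t. 0 \<le> c t\<close> by (simp add: suminf_ennreal2)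
  finally have "AE \<omega> in M. (\<Sum>t. ennreal ((X t \<omega>)\<^sup>2)) \<noteq> \<infinity>"
    by (intro nn_integral_PInf_AE) auto
  then show ?thesis
  proof eventually_elim
    case (elim \<omega>)
    then have "summable (\<lambda>t. (X t \<omega>)\<^sup>2)"
      by (intro summable_suminf_not_top) auto
    then have "(\<lambda>t. (X t \<omega>)\<^sup>2) \<longlonglongrightarrow> 0" by (rule summable_LIMSEQ_zero)
    then have "(\<lambda>t. sqrt ((X t \<omega>)\<^sup>2)) \<longlonglongrightarrow> sqrt 0" by (rule tendsto_real_sqrt)
    then show ?case by (simp add: tendsto_rabs_zero_iff)
  qed
qed

lemma AE_pair_corr_LIMSEQ:
  assumes "infinite A" and "strict_mono M" and "s > 0"
    and sum: "summable (\<lambda>t. real (additive_energy (initial_part A (M t))) / real (M t) ^ 3)"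
  shows "AE \<omega> in torus2_measure. (\<lambda>t. pair_corr (fst \<omega>) (snd \<omega>) s (M t) A) \<longlonglongrightarrow> 2 * s"
proof -
  \<comment> \<open>Dropping the first k terms leaves only values of \<open>M\<close> above 2s,
    where the variance bound applies; the limit is unaffected.\<close>
  obtain k :: nat where k: "real k > 2 * s" using reals_Archimedean2 by blast
  have big: "real (M (t + k)) > 2 * s" for t
  proof -
    have "k \<le> M (t + k)" using seq_suble[OF assms(2), of "t + k"] by simp
    then show ?thesis using k by linarith
  qed
  \<comment> \<open>The loss from excluding the diagonal disappears in the limit.\<close>
  have lim: "(\<lambda>t. 2 * s * (1 - 1 / real (M (t + k)))) \<longlonglongrightarrow> 2 * s * (1 - 0)"
  proof (intro tendsto_intros)
    have "strict_mono (\<lambda>t. M (t + k))" using assms(2) by (simp add: strict_mono_def)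
    then have "filterlim (\<lambda>t. M (t + k)) at_top sequentially" by (rule filterlim_subseq)
    then show "(\<lambda>t. 1 / real (M (t + k))) \<longlonglongrightarrow> 0"
      by (rule filterlim_compose[OF lim_1_over_n])
  qed
  let ?X = "\<lambda>t \<omega>. pair_corr (fst \<omega>) (snd \<omega>) s (M (t + k)) A - 2 * s * (1 - 1 / real (M (t + k)))"
  have "AE \<omega> in torus2_measure. (\<lambda>t. ?X t \<omega>) \<longlonglongrightarrow> 0"
  proof (rule torus2.AE_LIMSEQ_of_summable_second_moment)
    fix t
    note [measurable] = pair_corr_variance(2)[OF assms(1,3) big[of t]]
    show "integrable torus2_measure (\<lambda>\<omega>. (?X t \<omega>)\<^sup>2)"
    proof (rule torus2.integrable_const_bound[where B = "(real (M (t + k)) + 2 * s)\<^sup>2"])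
      show "AE \<omega> in torus2_measure. norm ((?X t \<omega>)\<^sup>2) \<le> (real (M (t + k)) + 2 * s)\<^sup>2"
      proof (rule AE_I2)
        fix \<omega>
        have "real (M (t + k)) > 0" using big[of t] assms(3) by linarith
        then have "real (M (t + k)) \<ge> 1" by simp
        then have "2 * s * (1 - 1 / real (M (t + k))) \<in> {0..2 * s}"
          using assms(3) by (auto simp: field_simps)
        then have "\<bar>?X t \<omega>\<bar> \<le> real (M (t + k)) + 2 * s"
          using pair_corr_bounded[of "fst \<omega>" "snd \<omega>" s "M (t + k)" A] unfolding atLeastAtMost_iff by linarith
        then show "norm ((?X t \<omega>)\<^sup>2) \<le> (real (M (t + k)) + 2 * s)\<^sup>2"
          using power_mono[of "\<bar>?X t \<omega>\<bar>" _ 2] by simp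
      qed
    qed measurable
    show "torus2.expectation (\<lambda>\<omega>. (?X t \<omega>)\<^sup>2)
      \<le> 2 * s * (real (additive_energy (initial_part A (M (t + k)))) / real (M (t + k)) ^ 3)"
      by (rule pair_corr_variance(1)[OF assms(1,3) big])
  next
    show "summable (\<lambda>t. 2 * s * (real (additive_energy (initial_part A (M (t + k)))) / real (M (t + k)) ^ 3))"
      using summable_ignore_initial_segment[OF sum, of k] by (rule summable_mult)
  qed
  then show ?thesis
  proof eventually_elim
    case (elim \<omega>)
    from tendsto_add[OF this lim]
    have "(\<lambda>t. pair_corr (fst \<omega>) (snd \<omega>) s (M (t + k)) A) \<longlonglongrightarrow> 2 * s" by simp
    then show ?case by (rule LIMSEQ_offset)
  qed
qed

section \<open>From rational to real s, and the choice of the subsequence\<close>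

text \<open>Monotonicity traps f s between the values at rationals just below and just above s,
  whose limits are as close to c s as desired.\<close>

lemma LIMSEQ_of_mono_on_Rats:
  fixes f :: "real \<Rightarrow> nat \<Rightarrow> real"
  assumes mono: "\<And>x y t. x \<le> y \<Longrightarrow> f x t \<le> f y t"
    and lim: "\<And>q. q \<in> \<rat> \<Longrightarrow> q > 0 \<Longrightarrow> f q \<longlonglongrightarrow> c * q" and "c > 0" and "s > 0"
  shows "f s \<longlonglongrightarrow> c * s"
proof (rule order_tendstoI)
  fix a assume "a < c * s"
  \<comment> \<open>The maximum with 0 keeps the rational chosen below s positive, where its limit
    is known.\<close>
  then have "max 0 (a / c) < s" using \<open>c > 0\<close> \<open>s > 0\<close> by (simp add: field_simps)
  then obtain q where q: "q \<in> \<rat>" "max 0 (a / c) < q" "q < s" using Rats_dense_in_real by blast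
  then have "a < c * q" using \<open>c > 0\<close> by (simp add: field_simps)
  then have "\<forall>\<^sub>F t in sequentially. a < f q t" using lim[of q] q by (intro order_tendstoD) auto
  then show "\<forall>\<^sub>F t in sequentially. a < f s t"
    by eventually_elim (use mono[of q s] q in \<open>meson less_le_trans less_imp_le\<close>)
next
  fix a assume "c * s < a"
  then have "s < a / c" using \<open>c > 0\<close> by (simp add: field_simps)
  then obtain q where q: "q \<in> \<rat>" "s < q" "q < a / c" using Rats_dense_in_real by blast
  then have "c * q < a" using \<open>c > 0\<close> by (simp add: field_simps)
  then have "\<forall>\<^sub>F t in sequentially. f q t < a" using lim[of q] q \<open>s > 0\<close> by (intro order_tendstoD) auto
  then show "\<forall>\<^sub>F t in sequentially. f s t < a"
    by eventually_elim (use mono[of s q] q in \<open>meson le_less_trans less_imp_le\<close>)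
qed

text \<open>Indices are chosen recursively so that the terms are dominated by a geometric
  series.\<close>

lemma subseq_summable:
  fixes x :: "nat \<Rightarrow> real"
  assumes "x \<longlonglongrightarrow> 0" and nonneg: "\<And>t. 0 \<le> x t"
  shows "\<exists>r. strict_mono r \<and> summable (x \<circ> r)"
proof -
  have "\<exists>m>n. x m \<le> (1/2) ^ k" for n k
  proof -
    have "\<forall>\<^sub>F m in sequentially. x m < (1/2) ^ k" using assms(1) by (rule order_tendstoD) simp
    then obtain m0 where "\<forall>m\<ge>m0. x m < (1/2) ^ k" by (auto simp: eventually_sequentially)
    then show ?thesis by (intro exI[of _ "max m0 (Suc n)"]) (auto intro: less_imp_le)
  qed
  \<comment> \<open>The choice at index 0 is unconstrained, so summability is first shown for the
    shifted sequence.\<close>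
  then obtain r where r: "\<And>k. x (r (Suc k)) \<le> (1/2) ^ k \<and> r (Suc k) > r k"
    using dependent_nat_choice[of "\<lambda>_ _. True" "\<lambda>k n m. x m \<le> (1/2) ^ k \<and> n < m"] by blast
  have "summable (\<lambda>k. x (r (Suc k)))"
    using r nonneg by (intro summable_comparison_test'[OF summable_geometric[of "1/2::real"]]) auto
  then have "summable (x \<circ> r)" using summable_Suc_iff[of "x \<circ> r"] by simp
  moreover have "strict_mono r" using r by (simp add: strict_mono_Suc_iff)
  ultimately show ?thesis by blast
qed

theorem theorem2p4:
  fixes A :: "nat set" and N :: "nat \<Rightarrow> nat"
  assumes "infinite A" and "0 \<notin> A"
    and "strict_mono N" and "\<forall>t. N t \<ge> 1"
    and "(\<lambda>t. real (additive_energy (initial_part A (N t))) / real (N t) ^ 3) \<longlonglongrightarrow> 0"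
  shows "\<exists>r. strict_mono r \<and> doubly_metric_poissonian_along A (N \<circ> r)"
proof -
  obtain r where r: "strict_mono r"
    and sum: "summable (\<lambda>t. real (additive_energy (initial_part A ((N \<circ> r) t))) / real ((N \<circ> r) t) ^ 3)"
    using subseq_summable[OF assms(5)] by (auto simp: o_def)
  have mono: "strict_mono (N \<circ> r)" using assms(3) r by (rule strict_mono_o)
  \<comment> \<open>The exceptional null set depends on s, so only countably many values are
    combined here; the remaining real s follow pointwise outside the common null set.\<close>
  have "AE \<omega> in torus2_measure. \<forall>q\<in>\<rat> \<inter> {0<..}.
      (\<lambda>t. pair_corr (fst \<omega>) (snd \<omega>) q ((N \<circ> r) t) A) \<longlonglongrightarrow> 2 * q"
    using AE_pair_corr_LIMSEQ[OF assms(1) mono _ sum]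
    by (subst AE_ball_countable) (auto intro: countable_rat)
  then have "AE \<omega> in torus2_measure. \<forall>s>0.
      (\<lambda>t. pair_corr (fst \<omega>) (snd \<omega>) s ((N \<circ> r) t) A) \<longlonglongrightarrow> 2 * s"
  proof eventually_elim
    case (elim \<omega>)
    let ?f = "\<lambda>s t. pair_corr (fst \<omega>) (snd \<omega>) s ((N \<circ> r) t) A"
    have "?f q \<longlonglongrightarrow> 2 * q" if "q \<in> \<rat>" "q > 0" for q
      using elim that by blast
    then show ?case
      using LIMSEQ_of_mono_on_Rats[of ?f 2] pair_corr_mono by simp
  qed
  then show ?thesis
    using r unfolding doubly_metric_poissonian_along_def by (auto simp: split_def)
qed

end
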